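(* Let $u$ be a non-zero polynomial in $\mathbb{Z}\langle{\bf c},{\bf d}\rangle$ with non-negative coefficients. Then there exists a bounded balanced labeled acyclic digraph $G$ whose relation on the set of labels is a linear order and which satisfies $\Psi(G)=u$.
   Context: A labeled acyclic digraph $G=(V,E)$ is a directed graph (multiple edges allowed) with no directed cycles, locally finite, with a set $\Lambda$ carrying a binary relation $\sim$ and a labeling $\lambda:E\to\Lambda$; it is bounded if it has a unique source $\hat0$ and unique sink $\hat1$. "The relation is a linear order" means $\sim$ is a strict total order $<$ on $\Lambda$. Paths, $x\le y$ and intervals $[x,y]=\{z:x\le z\le y\}$ are as usual. A path $(e_1,\dots,e_k)$ is rising if $\lambda(e_i)\sim\lambda(e_{i+1})$ for all $i\le k-1$ and falling if $\lambda(e_i)\not\sim\lambda(e_{i+1})$ for all $i\le k-1$. $G$ is balanced if for every interval $[x,y]$ and every $k\ge0$ the numbers of rising and of falling paths from $x$ to $y$ of length $k$ agree. The descent word of a path $p=(e_1,\dots,e_k)$ is $u(p)=u_1\cdots u_{k-1}$ in non-commuting ${\bf a},{\bf b}$ with $u_i={\bf a}$ if $\lambda(e_i)\sim\lambda(e_{i+1})$ and ${\bf b}$ otherwise; $\Psi(G)=\sum_p u(p)$ over paths from $\hat0$ to $\hat1$. ${\bf c}={\bf a}+{\bf b}$, ${\bf d}={\bf a}{\bf b}+{\bf b}{\bf a}$, and $\mathbb{Z}\langle{\bf c},{\bf d}\rangle$ denotes integer polynomials in ${\bf c},{\bf d}$ (coefficients taken with respect to ${\bf c}{\bf d}$-monomials).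 *)

theory Defs
  imports "Graph_Theory.Graph_Theory" "HOL-Library.Poly_Mapping"
begin

text \<open>Words form the free monoid, written additively because \<^typ>\<open>'a \<Rightarrow>\<^sub>0 'b\<close> takes its
  convolution product over an additive monoid of exponents.\<close>

instantiation list :: (type) monoid_add
begin
definition zero_list :: "'a list" where "zero_list = []"
definition plus_list :: "'a list \<Rightarrow> 'a list \<Rightarrow> 'a list" where "plus_list xs ys = xs @ ys"
instance by standard (simp_all add: zero_list_def plus_list_def)
end

text \<open>\<open>'x ncpoly\<close> is the free associative ring on the letters \<open>'x\<close>: finitely supported
  integer combinations of words, with multiplication extending concatenation.\<close>

type_synonym 'x ncpoly = "'x list \<Rightarrow>\<^sub>0 int"

datatype ab = A | B
datatype cd = C | D

definition poly_a :: "ab ncpoly" where "poly_a = Poly_Mapping.single [A] 1"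
definition poly_b :: "ab ncpoly" where "poly_b = Poly_Mapping.single [B] 1"

text \<open>An element of \<open>\<int>\<langle>c,d\<rangle>\<close> is given by its coefficients on \<open>cd\<close>-monomials; \<open>cd_to_ab\<close> is the
  ring homomorphism into \<open>\<int>\<langle>a,b\<rangle>\<close> with \<open>c \<mapsto> a + b\<close> and \<open>d \<mapsto> ab + ba\<close>.\<close>

primrec cd_letter :: "cd \<Rightarrow> ab ncpoly" where
  "cd_letter C = poly_a + poly_b"
| "cd_letter D = poly_a * poly_b + poly_b * poly_a"

definition cd_to_ab :: "cd ncpoly \<Rightarrow> ab ncpoly" where
  "cd_to_ab u =
    (\<Sum>w\<in>Poly_Mapping.keys u. of_int (Poly_Mapping.lookup u w) * prod_list (map cd_letter w))"

text \<open>By acyclicity the directed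
  walks \<^const>\<open>pre_digraph.awalk\<close> are exactly the directed paths, as edge lists; this keeps
  parallel edges apart. Local finiteness means that any two vertices are joined by finitely
  many paths, so that the path counts and the sum over paths below are honest.\<close>

locale labeled_acyclic_digraph = wf_digraph G
  for G :: "('v, 'e) pre_digraph" (structure) +
  fixes \<Lambda> :: "'l set"
    and rel :: "'l \<Rightarrow> 'l \<Rightarrow> bool"
    and lab :: "'e \<Rightarrow> 'l"
  assumes acyclic: "\<nexists>p. cycle p"
    and locally_finite: "\<lbrakk>x \<in> verts G; y \<in> verts G\<rbrakk> \<Longrightarrow> finite {p. awalk x p y}"
    and rel_on: "rel i j \<Longrightarrow> i \<in> \<Lambda> \<and> j \<in> \<Lambda>"
    and lab_in: "e \<in> arcs G \<Longrightarrow> lab e \<in> \<Lambda>"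

definition is_source :: "('v, 'e) pre_digraph \<Rightarrow> 'v \<Rightarrow> bool" where
  "is_source G v \<longleftrightarrow> v \<in> verts G \<and> in_arcs G v = {}"

definition is_sink :: "('v, 'e) pre_digraph \<Rightarrow> 'v \<Rightarrow> bool" where
  "is_sink G v \<longleftrightarrow> v \<in> verts G \<and> out_arcs G v = {}"

definition bounded_digraph :: "('v, 'e) pre_digraph \<Rightarrow> bool" where
  "bounded_digraph G \<longleftrightarrow> (\<exists>!v. is_source G v) \<and> (\<exists>!v. is_sink G v)"

definition bottom :: "('v, 'e) pre_digraph \<Rightarrow> 'v" where
  "bottom G = (THE v. is_source G v)"

definition top_vertex :: "('v, 'e) pre_digraph \<Rightarrow> 'v" where
  "top_vertex G = (THE v. is_sink G v)"

definition strict_linear_order_rel :: "'l set \<Rightarrow> ('l \<Rightarrow> 'l \<Rightarrow> bool) \<Rightarrow> bool" where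
  "strict_linear_order_rel \<Lambda> rel \<longleftrightarrow> irreflp_on \<Lambda> rel \<and> transp_on \<Lambda> rel \<and> totalp_on \<Lambda> rel"

definition rising :: "('l \<Rightarrow> 'l \<Rightarrow> bool) \<Rightarrow> ('e \<Rightarrow> 'l) \<Rightarrow> 'e list \<Rightarrow> bool" where
  "rising rel lab p \<longleftrightarrow> successively (\<lambda>e f. rel (lab e) (lab f)) p"

definition falling :: "('l \<Rightarrow> 'l \<Rightarrow> bool) \<Rightarrow> ('e \<Rightarrow> 'l) \<Rightarrow> 'e list \<Rightarrow> bool" where
  "falling rel lab p \<longleftrightarrow> successively (\<lambda>e f. \<not> rel (lab e) (lab f)) p"

definition balanced :: "('v, 'e) pre_digraph \<Rightarrow> ('l \<Rightarrow> 'l \<Rightarrow> bool) \<Rightarrow> ('e \<Rightarrow> 'l) \<Rightarrow> bool" where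
  "balanced G rel lab \<longleftrightarrow>
    (\<forall>x y k. x \<rightarrow>\<^sup>*\<^bsub>G\<^esub> y \<longrightarrow>
      card {p. pre_digraph.awalk G x p y \<and> length p = k \<and> rising rel lab p} =
      card {p. pre_digraph.awalk G x p y \<and> length p = k \<and> falling rel lab p})"

definition descent_word :: "('l \<Rightarrow> 'l \<Rightarrow> bool) \<Rightarrow> ('e \<Rightarrow> 'l) \<Rightarrow> 'e list \<Rightarrow> ab list" where
  "descent_word rel lab p = map (\<lambda>(e, f). if rel (lab e) (lab f) then A else B) (zip p (tl p))"

text \<open>A path with \<open>k\<close> edges has a descent word of length \<open>k - 1\<close>, so the empty path has none.
  It must be left out of the sum, or a one-vertex graph would contribute the word \<open>1\<close>.\<close>

definition \<Psi> :: "('v, 'e) pre_digraph \<Rightarrow> ('l \<Rightarrow> 'l \<Rightarrow> bool) \<Rightarrow> ('e \<Rightarrow> 'l) \<Rightarrow> ab ncpoly" where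
  "\<Psi> G rel lab =
    (\<Sum>p | pre_digraph.awalk G (bottom G) p (top_vertex G) \<and> p \<noteq> [].
      Poly_Mapping.single (descent_word rel lab p) 1)"

end

theory Submission
  imports Defs "HOL-Library.Countable"
begin

text \<open>Every \<open>cd\<close>-word is realized by a chain of vertices joined by parallel arcs. The label sets of
  consecutive levels are \<open>{0}\<close> at first, then \<open>{k, -k}\<close> for a letter \<open>c\<close> and \<open>{k, -k}, {0}\<close> for a
  letter \<open>d\<close>, where the numbers \<open>k\<close> strictly increase along the chain. From any smaller label, \<open>\<plusminus>k\<close>
  gives an ascent and a descent, hence a factor \<open>c\<close>, and a subsequent \<open>0\<close> turns this into
  \<open>ab + ba\<close>. A sum of monomials is obtained by gluing chains in parallel at the source and the sink.
  Negating all labels maps paths to paths with the same endpoints and exchanges ascents and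
  descents, so the graph is balanced.\<close>

section \<open>Label levels attached to a cd-word\<close>

fun levels :: "int \<Rightarrow> cd list \<Rightarrow> int set list" where
  "levels k [] = []"
| "levels k (C # w) = {k, - k} # levels (k + 1) w"
| "levels k (D # w) = {k, - k} # {0} # levels (k + 1) w"

lemma levels_finite: "X \<in> set (levels k w) \<Longrightarrow> finite X"
  by (induction k w rule: levels.induct) auto

lemma levels_nonempty: "X \<in> set (levels k w) \<Longrightarrow> X \<noteq> {}"
  by (induction k w rule: levels.induct) auto

lemma levels_uminus: "X \<in> set (levels k w) \<Longrightarrow> l \<in> X \<Longrightarrow> - l \<in> X"
  by (induction k w rule: levels.induct) auto

text \<open>The preceding level \<open>X\<close> is kept general so that the induction can move from
  letter to letter: absolute values separate \<open>X\<close> from the fresh labels \<open>k\<close>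
  and \<open>- k\<close>, and \<open>0 < k\<close> separates these from 0. Balance rests on
  disjointness, since two equal consecutive labels form a descent both before and after
  negation.\<close>

lemma levels_successively_disjoint:
  assumes "\<And>l. l \<in> X \<Longrightarrow> \<bar>l\<bar> < k" "0 < k"
  shows "successively (\<lambda>X Y. X \<inter> Y = {}) (X # levels k w)"
  using assms
proof (induction k w arbitrary: X rule: levels.induct)
  case (2 k w)
  have "successively (\<lambda>X Y. X \<inter> Y = {}) ({k, - k} # levels (k + 1) w)"
    by (rule "2.IH") (use 2 in auto)
  then show ?case using 2(2,3) by force
next
  case (3 k w)
  have "successively (\<lambda>X Y. X \<inter> Y = {}) ({0} # levels (k + 1) w)"
    by (rule "3.IH") (use 3 in auto)
  then show ?case using 3(2,3) by force
qed simp

section \<open>Summing descent words over all choices of labels\<close>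

definition int_descent_word :: "int list \<Rightarrow> ab list" where
  "int_descent_word ls = map (\<lambda>(l, m). if l < m then A else B) (zip ls (tl ls))"

lemma single_descent_word_Cons:
  "Poly_Mapping.single (int_descent_word (l # m # ls)) (1::int) =
    (if l < m then poly_a else poly_b) * Poly_Mapping.single (int_descent_word (m # ls)) 1"
  by (simp add: int_descent_word_def poly_a_def poly_b_def mult_single plus_list_def)

lemma set_Cons_eq_image: "set_Cons X Y = (\<lambda>(x, xs). x # xs) ` (X \<times> Y)"
  by (auto simp: set_Cons_def)

lemma sum_set_Cons: "sum f (set_Cons X Y) = (\<Sum>x\<in>X. \<Sum>xs\<in>Y. f (x # xs))"
  by (simp add: set_Cons_eq_image sum.reindex inj_on_def sum.cartesian_product case_prod_unfold)

lemma finite_listset: "(\<And>X. X \<in> set L \<Longrightarrow> finite X) \<Longrightarrow> finite (listset L)"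
  by (induction L) (simp_all add: set_Cons_eq_image)

text \<open>The previous label lies strictly between \<open>- k\<close> and \<open>k\<close>, so
  going to \<open>k\<close> contributes a and going to \<open>- k\<close> contributes b, whatever
  \<open>l\<close> is. Since the sum over the later levels does not depend on the label chosen
  before them, it factors out; this is why \<open>l\<close> is arbitrary in the induction.\<close>

lemma sum_levels:
  assumes "\<bar>l\<bar> < k"
  shows "(\<Sum>ls\<in>listset (levels k w). Poly_Mapping.single (int_descent_word (l # ls)) 1) =
    prod_list (map cd_letter w)"
  using assms
proof (induction k w arbitrary: l rule: levels.induct)
  case (1 k)
  \<comment> \<open>A single label has the empty descent word, which is the zero of the exponent
    monoid and so gives the unit of the ring.\<close>
  have "Poly_Mapping.single ([] :: ab list) (1 :: int) = 1"
    by (metis zero_list_def single_one)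
  then show ?case by (simp add: int_descent_word_def)
next
  case (2 k w)
  have "k \<noteq> - k" "l < k" "\<not> l < - k" using 2(2) by auto
  with 2 show ?case
    by (simp add: sum_set_Cons single_descent_word_Cons algebra_simps flip: sum_distrib_left)
next
  case (3 k w)
  \<comment> \<open>The forced return to 0 is a descent from \<open>k\<close> and an ascent from
    \<open>- k\<close>, which yields ab + ba; \<open>k \<noteq> - k\<close> keeps both terms of the
    sum over the level.\<close>
  have "k \<noteq> - k" "l < k" "\<not> l < - k" "\<not> k < 0" "- k < 0" using 3(2) by auto
  with 3 show ?case
    by (simp add: sum_set_Cons single_descent_word_Cons algebra_simps flip: sum_distrib_left)
qed

section \<open>Balance from an involution on arcs\<close>

lemma balanced_involution:
  fixes G :: "('v, 'e) pre_digraph" (structure)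
  assumes \<sigma>: "\<And>e. e \<in> arcs G \<Longrightarrow> \<sigma> e \<in> arcs G \<and> \<sigma> (\<sigma> e) = e \<and> tail G (\<sigma> e) = tail G e \<and> head G (\<sigma> e) = head G e"
    and rel: "\<And>e f. e \<in> arcs G \<Longrightarrow> f \<in> arcs G \<Longrightarrow> head G e = tail G f \<Longrightarrow>
      rel (lab (\<sigma> e)) (lab (\<sigma> f)) \<longleftrightarrow> \<not> rel (lab e) (lab f)"
  shows "balanced G rel lab"
  unfolding balanced_def
proof (intro allI impI)
  fix x y k
  let ?R = "{p. pre_digraph.awalk G x p y \<and> length p = k \<and> rising rel lab p}"
  let ?F = "{p. pre_digraph.awalk G x p y \<and> length p = k \<and> falling rel lab p}"
  have cas: "pre_digraph.cas G v (map \<sigma> p) y = pre_digraph.cas G v p y"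
    if "set p \<subseteq> arcs G" for v p
    using that \<sigma> by (induction p arbitrary: v) (auto simp: pre_digraph.cas.simps)
  have awalk: "pre_digraph.awalk G x (map \<sigma> p) y" if "pre_digraph.awalk G x p y" for p
    using that cas \<sigma> unfolding pre_digraph.awalk_def by auto
  \<comment> \<open>\<open>P\<close> and \<open>Q\<close> are left free because this is used in both
    directions, from rising to falling and back.\<close>
  have step: "successively P (map \<sigma> p) = successively Q p"
    if "set p \<subseteq> arcs G" "pre_digraph.cas G v p y"
      and "\<And>e f. e \<in> arcs G \<Longrightarrow> f \<in> arcs G \<Longrightarrow> head G e = tail G f \<Longrightarrow> P (\<sigma> e) (\<sigma> f) = Q e f" for P Q v p
    using that
    by (induction p arbitrary: v rule: induct_list012) (auto simp: pre_digraph.cas.simps)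
  have rf: "rising rel lab (map \<sigma> p) = falling rel lab p" if "pre_digraph.awalk G x p y" for p
    using that step[of p x] rel unfolding pre_digraph.awalk_def rising_def falling_def by auto
  have fr: "falling rel lab (map \<sigma> p) = rising rel lab p" if "pre_digraph.awalk G x p y" for p
    using that step[of p x] rel unfolding pre_digraph.awalk_def rising_def falling_def by auto
  have inv: "map \<sigma> (map \<sigma> p) = p" if "pre_digraph.awalk G x p y" for p
    using that \<sigma> unfolding pre_digraph.awalk_def by (auto intro!: map_idI)
  have "bij_betw (map \<sigma>) ?R ?F"
    by (rule bij_betw_byWitness[where f' = "map \<sigma>"])
      (use awalk rf fr inv in \<open>auto simp del: map_map\<close>)
  then show "card ?R = card ?F" by (rule bij_betw_same_card)
qed

section \<open>The graph of parallel chains\<close>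

text \<open>Each member of \<open>Ls\<close> is one chain; its entries are the label sets of the
  parallel arcs between consecutive vertices. Nothing here refers to cd-words: closure under
  negation and disjointness are what balance draws on.\<close>

locale parallel_chains =
  fixes Ls :: "int set list list"
  assumes Ls_nonempty: "Ls \<noteq> []"
    and chain_nonempty: "L \<in> set Ls \<Longrightarrow> L \<noteq> []"
    and level_finite: "L \<in> set Ls \<Longrightarrow> X \<in> set L \<Longrightarrow> finite X"
    and level_nonempty: "L \<in> set Ls \<Longrightarrow> X \<in> set L \<Longrightarrow> X \<noteq> {}"
    and level_uminus: "L \<in> set Ls \<Longrightarrow> X \<in> set L \<Longrightarrow> l \<in> X \<Longrightarrow> - l \<in> X"
    and level_disjoint: "L \<in> set Ls \<Longrightarrow> successively (\<lambda>X Y. X \<inter> Y = {}) L"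
begin

text \<open>All chains share the source 0 and the sink 1; the two successors keep the encoded inner
  vertices away from both.\<close>

definition vtx :: "nat \<Rightarrow> nat \<Rightarrow> nat" where
  "vtx i j = (if j = 0 then 0 else if length (Ls ! i) \<le> j then 1
    else Suc (Suc (prod_encode (i, j))))"

text \<open>Recording the chain index keeps arcs of repeated chains apart, even when they join
  source and sink directly.\<close>

definition edge :: "nat \<Rightarrow> nat \<Rightarrow> int \<Rightarrow> nat" where
  "edge i j l = to_nat (i, j, l)"

definition chain_of :: "nat \<Rightarrow> nat" where
  "chain_of e = fst (from_nat e :: nat \<times> nat \<times> int)"

definition level_of :: "nat \<Rightarrow> nat" where
  "level_of e = fst (snd (from_nat e :: nat \<times> nat \<times> int))"

definition label_of :: "nat \<Rightarrow> int" where
  "label_of e = snd (snd (from_nat e :: nat \<times> nat \<times> int))"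

lemma edge_simps [simp]:
  "chain_of (edge i j l) = i" "level_of (edge i j l) = j" "label_of (edge i j l) = l"
  by (simp_all add: edge_def chain_of_def level_of_def label_of_def)

lemma edge_inject [simp]: "edge i j l = edge i' j' l' \<longleftrightarrow> i = i' \<and> j = j' \<and> l = l'"
  by (simp add: edge_def)

definition graph :: "(nat, nat) pre_digraph" where
  "graph = \<lparr> verts = {vtx i j | i j. i < length Ls \<and> j \<le> length (Ls ! i)},
    arcs = {edge i j l | i j l. i < length Ls \<and> j < length (Ls ! i) \<and> l \<in> Ls ! i ! j},
    tail = (\<lambda>e. vtx (chain_of e) (level_of e)),
    head = (\<lambda>e. vtx (chain_of e) (Suc (level_of e))) \<rparr>"

text \<open>Labels are integers coded as naturals; \<open>rel\<close> is the integer order carried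
  along this bijection.\<close>

definition lab :: "nat \<Rightarrow> nat" where
  "lab e = int_encode (label_of e)"

definition rel :: "nat \<Rightarrow> nat \<Rightarrow> bool" where
  "rel l m \<longleftrightarrow> int_decode l < int_decode m"

text \<open>The position along the chain. The sink gets the total length of all chains, a common
  bound for the length of each of them.\<close>

definition rank :: "nat \<Rightarrow> nat" where
  "rank v = (if v = 0 then 0 else if v = 1 then sum_list (map length Ls)
    else snd (prod_decode (v - 2)))"

lemma verts_graph: "verts graph = {vtx i j | i j. i < length Ls \<and> j \<le> length (Ls ! i)}"
  and tail_graph: "tail graph e = vtx (chain_of e) (level_of e)"
  and head_graph: "head graph e = vtx (chain_of e) (Suc (level_of e))"
  by (simp_all add: graph_def)

lemma arcs_graph:
  "arcs graph = {edge i j l | i j l. i < length Ls \<and> j < length (Ls ! i) \<and> l \<in> Ls ! i ! j}"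
  by (simp add: graph_def)

lemma edge_in_graph:
  "edge i j l \<in> arcs graph \<longleftrightarrow> i < length Ls \<and> j < length (Ls ! i) \<and> l \<in> Ls ! i ! j"
  by (auto simp: arcs_graph)

lemma vtx_in_verts: "i < length Ls \<Longrightarrow> j \<le> length (Ls ! i) \<Longrightarrow> vtx i j \<in> verts graph"
  by (auto simp: verts_graph)

lemma length_chain_pos: "i < length Ls \<Longrightarrow> 0 < length (Ls ! i)"
  using chain_nonempty by simp

lemma vtx_0 [simp]: "vtx i 0 = 0"
  by (simp add: vtx_def)

lemma vtx_eq_0 [simp]: "vtx i j = 0 \<longleftrightarrow> j = 0"
  by (simp add: vtx_def)

lemma vtx_eq_Suc_0 [simp]: "vtx i j = Suc 0 \<longleftrightarrow> 0 < j \<and> length (Ls ! i) \<le> j"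
  by (simp add: vtx_def)

text \<open>One side is not the source and the other is not the sink, so the common vertex is inner
  and its code determines chain and position. The head of one arc and the tail of the next are in
  exactly this situation.\<close>

lemma vtx_inner_inject:
  assumes "vtx i j = vtx i' j'" "0 < j" "j' < length (Ls ! i')"
  shows "i = i' \<and> j = j'"
  using assms by (auto simp: vtx_def split: if_splits)

lemma sink_eq_vtx: "i < length Ls \<Longrightarrow> vtx i (length (Ls ! i)) = Suc 0"
  using length_chain_pos by simp

sublocale wf_digraph graph
  by unfold_locales (auto simp: arcs_graph tail_graph head_graph intro!: vtx_in_verts)

lemma finite_arcs_graph: "finite (arcs graph)"
proof -
  have "arcs graph = (\<Union>i<length Ls. \<Union>j<length (Ls ! i). edge i j ` (Ls ! i ! j))"
    by (auto simp: arcs_graph)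
  then show ?thesis by (auto intro: level_finite[OF nth_mem nth_mem])
qed

section \<open>Acyclicity, local finiteness, source and sink\<close>

lemma rank_vtx:
  "i < length Ls \<Longrightarrow> j < length (Ls ! i) \<Longrightarrow> rank (vtx i j) = j"
  by (simp add: rank_def vtx_def)

lemma rank_less:
  assumes "e \<in> arcs graph"
  shows "rank (tail graph e) < rank (head graph e)"
proof -
  obtain i j l where e: "e = edge i j l" "i < length Ls" "j < length (Ls ! i)"
    using assms by (auto simp: arcs_graph)
  have "length (Ls ! i) \<le> sum_list (map length Ls)"
    using e by (intro member_le_sum_list) auto
  then have "j < rank (vtx i (Suc j))"
    using e rank_vtx[of i "Suc j"] by (cases "Suc j < length (Ls ! i)") (auto simp: vtx_def rank_def)
  then show ?thesis
    using e rank_vtx[of i j] by (simp add: tail_graph head_graph)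
qed

lemma rank_awalk: "awalk x p y \<Longrightarrow> rank x + length p \<le> rank y"
proof (induction p arbitrary: x)
  case (Cons e p)
  then show ?case using rank_less[of e] by (fastforce simp: awalk_Cons_iff)
qed (simp add: awalk_Nil_iff)

lemma labeled_acyclic_digraph_graph: "labeled_acyclic_digraph graph UNIV rel lab"
proof unfold_locales
  \<comment> \<open>A cycle would be a nonempty path along which the rank returns to its initial
    value.\<close>
  show "\<nexists>p. cycle p"
    using rank_awalk by (fastforce simp: cycle_def)
  \<comment> \<open>The rank of \<open>y\<close> bounds the length of every such path, and there are
    finitely many arcs to choose from.\<close>
  show "finite {p. awalk x p y}" for x y
    by (rule finite_subset[OF _ finite_lists_length_le[OF finite_arcs_graph, of "rank y"]])
      (use rank_awalk in \<open>fastforce simp: awalk_def\<close>)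
qed auto

text \<open>No arc ends at position 0 of a chain, and any other vertex is entered from the nonempty
  level just before it. The sink is treated dually.\<close>

lemma is_source_iff: "is_source graph v \<longleftrightarrow> v = 0"
proof
  assume v: "is_source graph v"
  then obtain i j where ij: "v = vtx i j" "i < length Ls" "j \<le> length (Ls ! i)"
    by (auto simp: is_source_def verts_graph)
  show "v = 0"
  proof (rule ccontr)
    assume "v \<noteq> 0"
    with ij obtain j' where j': "j = Suc j'" by (cases j) auto
    then obtain l where "l \<in> Ls ! i ! j'"
      using level_nonempty[of "Ls ! i" "Ls ! i ! j'"] ij by (auto simp: Suc_le_eq)
    with ij j' have "edge i j' l \<in> in_arcs graph v"
      by (simp add: edge_in_graph head_graph Suc_le_eq)
    then show False using v unfolding is_source_def by blast
  qed
next
  have "0 \<in> verts graph"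
    using Ls_nonempty by (force simp: verts_graph)
  then show "v = 0 \<Longrightarrow> is_source graph v"
    by (auto simp: is_source_def in_arcs_def head_graph)
qed

lemma is_sink_iff: "is_sink graph v \<longleftrightarrow> v = 1"
proof
  assume v: "is_sink graph v"
  then obtain i j where ij: "v = vtx i j" "i < length Ls" "j \<le> length (Ls ! i)"
    by (auto simp: is_sink_def verts_graph)
  show "v = 1"
  proof (rule ccontr)
    assume "v \<noteq> 1"
    with ij have j: "j < length (Ls ! i)"
      using sink_eq_vtx[of i] by (cases "j = length (Ls ! i)") auto
    then obtain l where "l \<in> Ls ! i ! j"
      using level_nonempty[of "Ls ! i" "Ls ! i ! j"] ij by auto
    with ij j have "edge i j l \<in> out_arcs graph v"
      by (simp add: edge_in_graph tail_graph)
    then show False using v unfolding is_sink_def by blast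
  qed
next
  have "1 \<in> verts graph"
    using Ls_nonempty vtx_in_verts[of 0 "length (Ls ! 0)"] sink_eq_vtx[of 0] by simp
  then show "v = 1 \<Longrightarrow> is_sink graph v"
    by (auto simp: is_sink_def out_arcs_def tail_graph arcs_graph)
qed

lemma bounded_digraph_graph: "bounded_digraph graph"
  by (simp add: bounded_digraph_def is_source_iff is_sink_iff)

lemma bottom_graph: "bottom graph = 0" and top_vertex_graph: "top_vertex graph = 1"
  by (simp_all add: bottom_def top_vertex_def is_source_iff is_sink_iff)

section \<open>Linear order and balance\<close>

lemma strict_linear_order_rel: "strict_linear_order_rel UNIV rel"
  unfolding strict_linear_order_rel_def rel_def
  by (auto intro!: irreflp_onI transp_onI totalp_onI) (metis int_decode_inverse linorder_neqE)

lemma balanced_graph: "balanced graph rel lab"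
proof (rule balanced_involution[where \<sigma> = "\<lambda>e. edge (chain_of e) (level_of e) (- label_of e)"])
  fix e f assume "e \<in> arcs graph" "f \<in> arcs graph" and ht: "head graph e = tail graph f"
  then obtain i j l i' j' l'
    where e: "e = edge i j l" "i < length Ls" "j < length (Ls ! i)" "l \<in> Ls ! i ! j"
      and f: "f = edge i' j' l'" "i' < length Ls" "j' < length (Ls ! i')" "l' \<in> Ls ! i' ! j'"
    by (auto simp: arcs_graph)
  \<comment> \<open>Composable arcs meet at an inner vertex, hence lie on consecutive levels of one
    chain. Their labels then differ, and for distinct integers negation reverses the
    comparison.\<close>
  from ht have "i = i'" "Suc j = j'"
    using vtx_inner_inject[of i "Suc j" i' j'] e f by (auto simp: head_graph tail_graph)
  then have "(Ls ! i ! j) \<inter> (Ls ! i' ! j') = {}"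
    using level_disjoint[of "Ls ! i"] e f by (auto simp: successively_conv_nth)
  then have "l \<noteq> l'" using e f by auto
  then show "rel (lab (edge (chain_of e) (level_of e) (- label_of e)))
      (lab (edge (chain_of f) (level_of f) (- label_of f))) \<longleftrightarrow> \<not> rel (lab e) (lab f)"
    using e f by (auto simp: rel_def lab_def)
qed (auto simp: arcs_graph tail_graph head_graph intro: level_uminus[OF nth_mem nth_mem])

section \<open>Paths from source to sink\<close>

fun walk :: "nat \<Rightarrow> nat \<Rightarrow> int list \<Rightarrow> nat list" where
  "walk i j [] = []"
| "walk i j (l # ls) = edge i j l # walk i (Suc j) ls"

lemma walk_inject: "walk i j ls = walk i j ls' \<longleftrightarrow> ls = ls'"
proof (induction ls arbitrary: j ls')
  case Nil
  then show ?case by (cases ls') auto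
next
  case (Cons l ls)
  then show ?case by (cases ls') auto
qed

lemma Cons_in_walk_set_Cons:
  "e # q \<in> walk i j ` set_Cons X S \<longleftrightarrow> e \<in> edge i j ` X \<and> q \<in> walk i (Suc j) ` S"
  by (force simp: set_Cons_eq_image)

lemma descent_word_walk: "descent_word rel lab (walk i j ls) = int_descent_word ls"
proof (induction ls arbitrary: j rule: induct_list012)
  case (3 l m ls)
  then show ?case
    using "3.IH"(2)[of "Suc j"] by (simp add: descent_word_def int_descent_word_def rel_def lab_def)
qed (simp_all add: descent_word_def int_descent_word_def)

lemma sink_in_verts: "Suc 0 \<in> verts graph"
  using is_sink_iff[of 1] by (simp add: is_sink_def)

text \<open>Once the source is left, the chain is fixed and only labels remain to be chosen. The
  condition \<open>0 < j\<close> is essential, as at the source every chain is available. The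
  induction is on the distance to the sink.\<close>

lemma awalk_vtx_sink_iff:
  assumes "i < length Ls" "0 < j" "j \<le> length (Ls ! i)"
  shows "awalk (vtx i j) p (Suc 0) \<longleftrightarrow> p \<in> walk i j ` listset (drop j (Ls ! i))"
  using assms
proof (induction "length (Ls ! i) - j" arbitrary: j p)
  case 0
  then have sink: "vtx i j = Suc 0" by simp
  \<comment> \<open>A path from the sink to itself is empty, because the rank leaves no room for an
    arc.\<close>
  have "awalk (Suc 0) p (Suc 0) \<longleftrightarrow> p = []"
    using rank_awalk[of "Suc 0" p "Suc 0"] sink_in_verts by (auto simp: awalk_Nil_iff)
  then show ?case unfolding sink using 0 by simp
next
  case (Suc n)
  then have j: "j < length (Ls ! i)" by simp
  have IH: "awalk (vtx i (Suc j)) q (Suc 0) \<longleftrightarrow> q \<in> walk i (Suc j) ` listset (drop (Suc j) (Ls ! i))" for q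
    using Suc j by (intro Suc(1)) auto
  have drop: "drop j (Ls ! i) = (Ls ! i ! j) # drop (Suc j) (Ls ! i)"
    using j by (simp add: Cons_nth_drop_Suc)
  have ne: "vtx i j \<noteq> Suc 0" using j by simp
  have edge: "e \<in> arcs graph \<and> tail graph e = vtx i j \<longleftrightarrow> e \<in> edge i j ` (Ls ! i ! j)" for e
  proof
    assume e: "e \<in> arcs graph \<and> tail graph e = vtx i j"
    then obtain i' j' l where *: "e = edge i' j' l" "i' < length Ls" "j' < length (Ls ! i')" "l \<in> Ls ! i' ! j'"
      by (auto simp: arcs_graph)
    then have "i = i' \<and> j = j'"
      using e Suc.prems by (intro vtx_inner_inject) (simp_all add: tail_graph)
    then show "e \<in> edge i j ` (Ls ! i ! j)" using * by simp
  qed (use j Suc.prems in \<open>auto simp: edge_in_graph tail_graph\<close>)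
  show ?case
  proof (cases p)
    case Nil
    then show ?thesis using ne by (auto simp: awalk_Nil_iff drop set_Cons_def)
  next
    case (Cons e q)
    have "awalk (vtx i j) p (Suc 0) \<longleftrightarrow>
        e \<in> edge i j ` (Ls ! i ! j) \<and> awalk (head graph e) q (Suc 0)"
      using edge[of e] by (auto simp: Cons awalk_Cons_iff)
    also have "\<dots> \<longleftrightarrow> e \<in> edge i j ` (Ls ! i ! j) \<and> awalk (vtx i (Suc j)) q (Suc 0)"
      by (auto simp: head_graph)
    also have "\<dots> \<longleftrightarrow> p \<in> walk i j ` listset (drop j (Ls ! i))"
      by (simp add: IH Cons drop Cons_in_walk_set_Cons)
    finally show ?thesis .
  qed
qed

text \<open>The first arc selects a chain; the rest of the path is governed by the description of
  paths from an inner vertex or the sink.\<close>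

lemma awalk_source_sink:
  "{p. awalk 0 p 1 \<and> p \<noteq> []} = (\<Union>i<length Ls. walk i 0 ` listset (Ls ! i))"
proof (rule set_eqI)
  fix p
  have Cons: "awalk 0 (e # q) 1 \<longleftrightarrow>
      (\<exists>i<length Ls. e # q \<in> walk i 0 ` listset (Ls ! i))" for e q
  proof -
    have "awalk 0 (e # q) 1 \<longleftrightarrow> (\<exists>i l. i < length Ls \<and> l \<in> Ls ! i ! 0 \<and> e = edge i 0 l \<and>
        awalk (vtx i (Suc 0)) q (Suc 0))"
      using length_chain_pos by (fastforce simp: awalk_Cons_iff arcs_graph head_graph tail_graph)
    also have "\<dots> \<longleftrightarrow> (\<exists>i l. i < length Ls \<and> l \<in> Ls ! i ! 0 \<and> e = edge i 0 l \<and>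
        q \<in> walk i (Suc 0) ` listset (drop (Suc 0) (Ls ! i)))"
      using awalk_vtx_sink_iff[of _ "Suc 0" q] length_chain_pos by (auto simp: Suc_le_eq)
    also have "\<dots> \<longleftrightarrow> (\<exists>i<length Ls. e # q \<in> walk i 0 ` listset (Ls ! i))"
    proof -
      have "listset (Ls ! i) = set_Cons (Ls ! i ! 0) (listset (drop (Suc 0) (Ls ! i)))"
        if "i < length Ls" for i
        using length_chain_pos[OF that] by (cases "Ls ! i") auto
      then have "e # q \<in> walk i 0 ` listset (Ls ! i) \<longleftrightarrow>
          e \<in> edge i 0 ` (Ls ! i ! 0) \<and> q \<in> walk i (Suc 0) ` listset (drop (Suc 0) (Ls ! i))"
        if "i < length Ls" for i
        using that by (simp only: Cons_in_walk_set_Cons)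
      then show ?thesis by blast
    qed
    finally show ?thesis .
  qed
  have "[] \<notin> walk i 0 ` listset (Ls ! i)" if "i < length Ls" for i
    using length_chain_pos[OF that] by (cases "Ls ! i") (auto simp: set_Cons_def)
  then show "p \<in> {p. awalk 0 p 1 \<and> p \<noteq> []} \<longleftrightarrow>
      p \<in> (\<Union>i<length Ls. walk i 0 ` listset (Ls ! i))"
    using Cons by (cases p) auto
qed

lemma \<Psi>_graph:
  "\<Psi> graph rel lab =
    (\<Sum>L\<leftarrow>Ls. \<Sum>ls\<in>listset L. Poly_Mapping.single (int_descent_word ls) 1)"
proof -
  have fin: "finite (listset (Ls ! i))" if "i < length Ls" for i
    using level_finite[OF nth_mem[OF that]] by (rule finite_listset)
  \<comment> \<open>Paths in different chains already differ in their first arc, so repeated chains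
    are counted with multiplicity.\<close>
  have disj: "walk i 0 ` listset (Ls ! i) \<inter> walk i' 0 ` listset (Ls ! i') = {}"
    if "i < length Ls" "i' < length Ls" "i \<noteq> i'" for i i'
    using that length_chain_pos[of i] length_chain_pos[of i']
    by (cases "Ls ! i"; cases "Ls ! i'") (auto simp: set_Cons_def)
  have "\<Psi> graph rel lab = (\<Sum>i<length Ls. \<Sum>p\<in>walk i 0 ` listset (Ls ! i).
      Poly_Mapping.single (descent_word rel lab p) 1)"
    unfolding \<Psi>_def bottom_graph top_vertex_graph awalk_source_sink
    by (rule sum.UNION_disjoint) (use fin disj in auto)
  also have "\<dots> = (\<Sum>i<length Ls. \<Sum>ls\<in>listset (Ls ! i).
      Poly_Mapping.single (int_descent_word ls) 1)"
    by (simp add: sum.reindex inj_on_def walk_inject descent_word_walk)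
  also have "\<dots> = (\<Sum>L\<leftarrow>Ls. \<Sum>ls\<in>listset L. Poly_Mapping.single (int_descent_word ls) 1)"
    by (simp add: sum_list_sum_nth atLeast0LessThan)
  finally show ?thesis .
qed

end

section \<open>From a non-negative polynomial to a family of chains\<close>

lemma sum_as_sum_list:
  fixes c :: "'a \<Rightarrow> int" and f :: "'a \<Rightarrow> 'b :: ring_1"
  assumes "finite K" "\<And>x. 0 \<le> c x"
  obtains xs where "set xs = {x \<in> K. c x \<noteq> 0}" "(\<Sum>x\<in>K. of_int (c x) * f x) = sum_list (map f xs)"
proof -
  obtain ys where ys: "set ys = K" "distinct ys"
    using finite_distinct_list[OF assms(1)] by blast
  \<comment> \<open>Non-negativity lets a coefficient act as a multiplicity: each monomial is
    repeated that many times.\<close>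
  define xs where "xs = concat (map (\<lambda>x. replicate (nat (c x)) x) ys)"
  have "c x \<le> 0 \<longleftrightarrow> c x = 0" for x using assms(2)[of x] by auto
  then have "set xs = {x \<in> K. c x \<noteq> 0}"
    by (simp add: xs_def ys(1) set_replicate_conv_if set_eq_iff)
  moreover have "sum_list (map f xs) = (\<Sum>x\<leftarrow>ys. of_int (c x) * f x)"
    unfolding xs_def using assms(2)
    by (induction ys) (simp_all add: sum_list_replicate map_replicate)
  then have "(\<Sum>x\<in>K. of_int (c x) * f x) = sum_list (map f xs)"
    using ys by (simp add: sum_list_distinct_conv_sum_set)
  ultimately show thesis by (rule that)
qed

theorem theorem8p1:
  fixes u :: "cd ncpoly"
  assumes "u \<noteq> 0"
    and "\<And>w. Poly_Mapping.lookup u w \<ge> 0"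
  shows "\<exists>(G :: (nat, nat) pre_digraph) (\<Lambda> :: nat set) rel lab.
    labeled_acyclic_digraph G \<Lambda> rel lab \<and>
    bounded_digraph G \<and>
    strict_linear_order_rel \<Lambda> rel \<and>
    balanced G rel lab \<and>
    \<Psi> G rel lab = cd_to_ab u"
proof -
  obtain ws where ws: "set ws = {w \<in> Poly_Mapping.keys u. Poly_Mapping.lookup u w \<noteq> 0}"
    and u: "cd_to_ab u = (\<Sum>w\<leftarrow>ws. prod_list (map cd_letter w))"
    unfolding cd_to_ab_def
    by (rule sum_as_sum_list[of "Poly_Mapping.keys u" "Poly_Mapping.lookup u"]) (use assms(2) in auto)
  have "set ws = Poly_Mapping.keys u"
    unfolding ws by (auto simp: in_keys_iff)
  \<comment> \<open>This is where \<open>u \<noteq> 0\<close> enters: without a chain there would be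
    neither source nor sink.\<close>
  then have "ws \<noteq> []" using assms(1) by (metis keys_eq_empty set_empty)
  \<comment> \<open>The initial label 0 satisfies the bound of \<open>sum_levels\<close> for
    \<open>k = 1\<close>. It also turns the empty monomial into a single arc, whose descent word is
    1.\<close>
  define Ls where "Ls = map (\<lambda>w. {0} # levels 1 w) ws"
  interpret parallel_chains Ls
  proof
    show "successively (\<lambda>X Y. X \<inter> Y = {}) L" if "L \<in> set Ls" for L
      using that levels_successively_disjoint[of "{0}" 1] by (auto simp: Ls_def)
  qed (use \<open>ws \<noteq> []\<close> in \<open>auto simp: Ls_def dest: levels_finite levels_nonempty levels_uminus\<close>)
  have "(\<Sum>ls\<in>listset ({0} # levels 1 w). Poly_Mapping.single (int_descent_word ls) 1) =
      prod_list (map cd_letter w)" for w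
    by (simp add: sum_set_Cons sum_levels)
  then have "\<Psi> graph rel lab = cd_to_ab u"
    unfolding \<Psi>_graph u by (simp add: Ls_def o_def del: listset.simps)
  then show ?thesis
    using labeled_acyclic_digraph_graph bounded_digraph_graph strict_linear_order_rel balanced_graph
    by blast
qed

end
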